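(* Let $(a_n)_{n\in\mathbb{N}}$ be real numbers and $(f_n)_{n\in\mathbb{N}}$ functions $\mathbb{R}\to\mathbb{R}$ such that $(a_n,f_n)_{n\in\mathbb{N}}\in\mathcal{F}_s$, and let $F\colon s\to\mathbb{R}$ be the associated $\mathcal{F}_s$-functional $$F(x)=\frac12\sum_{n=1}^\infty a_n x_n^2+\sum_{n=1}^\infty f_n(x_n).$$ Then $F$ admits a unique global minimum on $s$; that is, there is exactly one $x_0\in s$ with $F(x_0)\le F(x)$ for all $x\in s$.
   Context: $\mathbb{N}=\{1,2,\dots\}$ and $\mathbb{N}_0=\mathbb{N}\cup\{0\}$. The space $s$ of rapidly decreasing sequences is the Fréchet space of all $x=(x_n)\in\mathbb{R}^{\mathbb{N}}$ with $\|x\|_{s,k}:=\sup_n|x_n|n^k<\infty$ for all $k\in\mathbb{N}_0$, topologized by the norms $\|\cdot\|_{s,k}$. Class $\mathcal{F}_s$: the class of $(a_n,f_n)_{n\in\mathbb{N}}$ such that (A.1) there are constants $\alpha>0$, $M>0$ with $0<\alpha\le a_n\le M$ for all $n$; (A.2) each $f_n\in C^1(\mathbb{R})$ is convex; there are constants $\beta_n\ge 0$ with $(\beta_n)\in s$ and $|f_n(t)|\le\beta_n(1+t^2)$ for all $t\in\mathbb{R}$; and there are $\gamma_n\ge 0$ with $\sum_{n=1}^\infty\gamma_n<\infty$ and $f_n(t)\ge-\gamma_n$ for all $t\in\mathbb{R}$. For $(a_n,f_n)\in\mathcal{F}_s$ both series defining $F$ converge absolutely for every $x\in s$. *)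

theory Defs
  imports "HOL-Analysis.Analysis"
begin

text \<open>
  Sequences are indexed by \<open>{1..}\<close>, as the weights \<open>n ^ k\<close> are those of positive integers.
  The product of copies of the reals over \<open>{1..}\<close> is \<open>{1..} \<rightarrow>\<^sub>E UNIV\<close>:
  fixing the value at the unused index \<open>0\<close> is what makes equality of elements the
  equality of sequences.
  Membership says that every norm (the supremum over \<open>n \<ge> 1\<close>) is finite.
\<close>

definition rapidly_decreasing :: "(nat \<Rightarrow> real) set" where
  "rapidly_decreasing =
     {x \<in> {1..} \<rightarrow>\<^sub>E UNIV. \<forall>k::nat. bdd_above ((\<lambda>n. \<bar>x n\<bar> * real n ^ k) ` {1..})}"

definition class_Fs :: "((nat \<Rightarrow> real) \<times> (nat \<Rightarrow> real \<Rightarrow> real)) set" where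
  "class_Fs = {(a, f).
     (\<exists>\<alpha> M. \<alpha> > 0 \<and> M > 0 \<and> (\<forall>n\<ge>1. \<alpha> \<le> a n \<and> a n \<le> M)) \<and>
     (\<forall>n\<ge>1. f n C1_differentiable_on UNIV \<and> convex_on UNIV (f n)) \<and>
     (\<exists>\<beta>\<in>rapidly_decreasing. \<forall>n\<ge>1. \<beta> n \<ge> 0 \<and> (\<forall>t. \<bar>f n t\<bar> \<le> \<beta> n * (1 + t\<^sup>2))) \<and>
     (\<exists>\<gamma>. (\<forall>n\<ge>1. \<gamma> n \<ge> 0) \<and> summable (\<lambda>n. \<gamma> (Suc n)) \<and> (\<forall>n\<ge>1. \<forall>t. f n t \<ge> - \<gamma> n))}"

text \<open>
  The shift by \<open>Suc\<close> makes the series start at index \<open>1\<close>.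
  For \<open>(a, f) \<in> class_Fs\<close> both series converge absolutely at every \<open>x \<in> rapidly_decreasing\<close>;
  outside that set the value is meaningless.
\<close>

definition Fs_functional ::
  "(nat \<Rightarrow> real) \<Rightarrow> (nat \<Rightarrow> real \<Rightarrow> real) \<Rightarrow> (nat \<Rightarrow> real) \<Rightarrow> real" where
  "Fs_functional a f x =
     1 / 2 * (\<Sum>n. a (Suc n) * (x (Suc n))\<^sup>2) + (\<Sum>n. f (Suc n) (x (Suc n)))"

end

theory Submission
  imports Defs
begin

text \<open>
  The functional separates into the one-variable functions \<open>a t\<^sup>2 / 2 + f t\<close>, each of which is
  coercive and strictly convex, hence has a unique minimiser \<open>m\<close>. Comparing its value at \<open>m\<close>
  with that at \<open>0\<close> gives \<open>(\<alpha> / 2 - \<beta>) m\<^sup>2 \<le> 2 \<beta>\<close>; as \<open>\<beta>\<close> tends to \<open>0\<close> along the sequence, the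
  squares of the minimisers are eventually dominated by a multiple of \<open>\<beta>\<close>, so the minimisers
  form a rapidly decreasing sequence.
\<close>

lemma rapidly_decreasingE:
  assumes "x \<in> rapidly_decreasing"
  obtains C where "C \<ge> 0" "\<And>n. n \<ge> 1 \<Longrightarrow> \<bar>x n\<bar> * real n ^ k \<le> C"
proof -
  from assms have "bdd_above ((\<lambda>n. \<bar>x n\<bar> * real n ^ k) ` {1..})"
    by (simp add: rapidly_decreasing_def)
  then obtain C where C: "\<And>n. n \<ge> 1 \<Longrightarrow> \<bar>x n\<bar> * real n ^ k \<le> C"
    by (auto simp: bdd_above_def)
  have "0 \<le> \<bar>x 1\<bar>" by simp
  also have "\<dots> \<le> C" using C[of 1] by simp
  finally show thesis using C that by blast
qed

text \<open>Index \<open>0\<close> causes no trouble: membership in \<open>PiE\<close> forces both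
  sequences to be \<open>undefined\<close> there.\<close>

lemma rapidly_decreasing_eqI:
  assumes "x \<in> rapidly_decreasing" "y \<in> rapidly_decreasing" "\<And>n. x (Suc n) = y (Suc n)"
  shows "x = y"
proof (rule PiE_ext)
  show "x \<in> {1..} \<rightarrow>\<^sub>E UNIV" "y \<in> {1..} \<rightarrow>\<^sub>E UNIV"
    using assms(1,2) by (simp_all add: rapidly_decreasing_def)
  show "x n = y n" if "n \<in> {1..}" for n
    using assms(3)[of "n - 1"] that by simp
qed

lemma summable_inverse_squares_Suc: "summable (\<lambda>n. c / real (Suc n) ^ 2)"
  using summable_mult[OF sums_summable[OF inverse_squares_sums], of c] by (simp add: add.commute)

text \<open>The norm with \<open>k = 1\<close> gives |x n| \<le> C / n, so the terms are dominated
  by M C^2 / n^2.\<close>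

lemma summable_mult_power2_rapidly_decreasing:
  assumes "\<And>n. n \<ge> 1 \<Longrightarrow> \<bar>a n\<bar> \<le> M" and x: "x \<in> rapidly_decreasing"
  shows "summable (\<lambda>n. a (Suc n) * (x (Suc n))\<^sup>2)"
proof -
  obtain C where C: "C \<ge> 0" "\<And>n. n \<ge> 1 \<Longrightarrow> \<bar>x n\<bar> * real n ^ 1 \<le> C"
    using rapidly_decreasingE[OF x] by metis
  show ?thesis
  proof (rule summable_comparison_test'[OF summable_inverse_squares_Suc[of "M * C\<^sup>2"]])
    fix n
    have "\<bar>x (Suc n)\<bar> \<le> C / real (Suc n)"
      using C(2)[of "Suc n"] by (simp add: field_simps)
    then have "\<bar>x (Suc n)\<bar>\<^sup>2 \<le> (C / real (Suc n))\<^sup>2"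
      by (rule power_mono) simp
    then have "\<bar>a (Suc n)\<bar> * \<bar>x (Suc n)\<bar>\<^sup>2 \<le> M * (C / real (Suc n))\<^sup>2"
      using assms(1)[of "Suc n"] by (intro mult_mono) auto
    then show "norm (a (Suc n) * (x (Suc n))\<^sup>2) \<le> M * C\<^sup>2 / real (Suc n) ^ 2"
      by (simp add: abs_mult power_divide)
  qed
qed

text \<open>Boundedness of \<open>x\<close> (the norm with \<open>k = 0\<close>) makes 1 + (x n)^2
  bounded, and the norm with \<open>k = 2\<close> of \<beta> supplies the factor 1 / n^2.\<close>

lemma summable_comp_rapidly_decreasing:
  fixes f :: "nat \<Rightarrow> real \<Rightarrow> real"
  assumes \<beta>: "\<beta> \<in> rapidly_decreasing"
    and f: "\<And>n t. n \<ge> 1 \<Longrightarrow> \<bar>f n t\<bar> \<le> \<beta> n * (1 + t\<^sup>2)" and x: "x \<in> rapidly_decreasing"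
  shows "summable (\<lambda>n. f (Suc n) (x (Suc n)))"
proof -
  obtain B where B: "B \<ge> 0" "\<And>n. n \<ge> 1 \<Longrightarrow> \<bar>\<beta> n\<bar> * real n ^ 2 \<le> B"
    using rapidly_decreasingE[OF \<beta>] by metis
  obtain C where C: "C \<ge> 0" "\<And>n. n \<ge> 1 \<Longrightarrow> \<bar>x n\<bar> * real n ^ 0 \<le> C"
    using rapidly_decreasingE[OF x] by metis
  show ?thesis
  proof (rule summable_comparison_test'[OF summable_inverse_squares_Suc[of "B * (1 + C\<^sup>2)"]])
    fix n
    have "\<bar>x (Suc n)\<bar>\<^sup>2 \<le> C\<^sup>2"
      using C(2)[of "Suc n"] by (intro power_mono) auto
    moreover have "\<beta> (Suc n) \<le> B / real (Suc n) ^ 2"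
      using B(2)[of "Suc n"] by (simp add: pos_le_divide_eq mult.commute)
        (smt (verit) mult_right_mono zero_le_power2)
    ultimately have "\<beta> (Suc n) * (1 + (x (Suc n))\<^sup>2) \<le> B / real (Suc n) ^ 2 * (1 + C\<^sup>2)"
      using B(1) by (intro mult_mono) auto
    then show "norm (f (Suc n) (x (Suc n))) \<le> B * (1 + C\<^sup>2) / real (Suc n) ^ 2"
      using f[of "Suc n" "x (Suc n)"] by simp
  qed
qed

text \<open>Outside a compact interval around 0 the lower bound on \<open>f\<close> already pushes
  the function up to its value at 0, so a minimiser over the interval is a global one.\<close>

lemma ex_minimiser_quadratic_plus:
  fixes f :: "real \<Rightarrow> real"
  assumes "a > 0" "continuous_on UNIV f" and lower: "\<And>t. f t \<ge> - c"
  obtains m where "\<And>t. a / 2 * m\<^sup>2 + f m \<le> a / 2 * t\<^sup>2 + f t"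
proof -
  \<comment> \<open>\<open>R\<close> solves a / 2 * R^2 - c = f 0, where the right side is the value
    of the whole function at 0. The radicand is nonnegative because f 0 \<ge> - c.\<close>
  define R where "R = sqrt (2 * (f 0 + c) / a)"
  have R: "R\<^sup>2 = 2 * (f 0 + c) / a" "R \<ge> 0"
    using lower[of 0] \<open>a > 0\<close> by (simp_all add: R_def)
  have "continuous_on {-R..R} (\<lambda>t. a / 2 * t\<^sup>2 + f t)"
    by (intro continuous_intros continuous_on_subset[OF assms(2)]) auto
  then obtain m where m: "\<And>t. t \<in> {-R..R} \<Longrightarrow> a / 2 * m\<^sup>2 + f m \<le> a / 2 * t\<^sup>2 + f t"
    using continuous_attains_inf[of "{-R..R}"] R(2) by fastforce
  have "a / 2 * m\<^sup>2 + f m \<le> a / 2 * t\<^sup>2 + f t" for t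
  proof (cases "t \<in> {-R..R}")
    case False
    then have "R\<^sup>2 \<le> t\<^sup>2"
      using R(2) by (auto simp: abs_le_square_iff[symmetric])
    then have "f 0 + c \<le> a / 2 * t\<^sup>2"
      using \<open>a > 0\<close> by (simp add: R(1) field_simps)
    \<comment> \<open>As 0 lies in the interval, the value at \<open>m\<close> is at most f 0, hence
      at most a / 2 * t^2 - c, which the bound on \<open>f\<close> places below the value at
      \<open>t\<close>.\<close>
    then show ?thesis
      using m[of 0] R(2) lower[of t] by simp
  qed (rule m)
  then show thesis by (rule that)
qed

text \<open>If two minimisers differed, their midpoint would do strictly better: convexity controls
  \<open>f\<close> there, and the quadratic part gains a multiple of (y - m)^2.\<close>

lemma unique_minimiser_quadratic_plus_convex:
  fixes f :: "real \<Rightarrow> real"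
  assumes "a > 0" "convex_on UNIV f"
    and m: "\<And>t. a / 2 * m\<^sup>2 + f m \<le> a / 2 * t\<^sup>2 + f t"
    and y: "a / 2 * y\<^sup>2 + f y = a / 2 * m\<^sup>2 + f m"
  shows "y = m"
proof -
  have "f ((1 - 1/2) *\<^sub>R y + (1/2) *\<^sub>R m) \<le> (1 - 1/2) * f y + 1/2 * f m"
    by (rule convex_onD[OF assms(2)]) auto
  then have "f ((y + m) / 2) \<le> (f y + f m) / 2"
    by (simp add: field_simps)
  \<comment> \<open>The parallelogram identity, with the gain made explicit.\<close>
  moreover have "a / 2 * ((y + m) / 2)\<^sup>2 = (a / 2 * y\<^sup>2 + a / 2 * m\<^sup>2) / 2 - a / 8 * (y - m)\<^sup>2"
    by (simp add: power2_eq_square field_simps)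
  ultimately have "a / 8 * (y - m)\<^sup>2 \<le> 0"
    using m[of "(y + m) / 2"] y by argo
  then show ?thesis
    using \<open>a > 0\<close> by (simp add: mult_le_0_iff)
qed

text \<open>Squaring doubles the exponent of the weight, so the norm of order \<open>2 * k\<close>
  of \<beta> controls the norm of order \<open>k\<close> of \<open>m\<close>, up to finitely many
  indices.\<close>

lemma rapidly_decreasing_of_square_le:
  assumes \<beta>: "\<beta> \<in> rapidly_decreasing" and "c \<ge> 0" and m: "m \<in> {1..} \<rightarrow>\<^sub>E UNIV"
    and le: "\<And>n. n \<ge> N \<Longrightarrow> n \<ge> 1 \<Longrightarrow> (m n)\<^sup>2 \<le> c * \<beta> n"
  shows "m \<in> rapidly_decreasing"
proof -
  have "bdd_above ((\<lambda>n. \<bar>m n\<bar> * real n ^ k) ` {1..})" for k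
  proof -
    obtain B where B: "B \<ge> 0" "\<And>n. n \<ge> 1 \<Longrightarrow> \<bar>\<beta> n\<bar> * real n ^ (2 * k) \<le> B"
      using rapidly_decreasingE[OF \<beta>] by metis
    have "\<bar>m n\<bar> * real n ^ k \<le> sqrt (c * B)" if n: "n \<ge> N" "n \<ge> 1" for n
    proof (rule real_le_rsqrt)
      have "(\<bar>m n\<bar> * real n ^ k)\<^sup>2 = (m n)\<^sup>2 * real n ^ (2 * k)"
        by (simp add: power_mult_distrib mult.commute flip: power_mult)
      also have "\<dots> \<le> c * \<bar>\<beta> n\<bar> * real n ^ (2 * k)"
        using le[OF n] mult_left_mono[OF abs_ge_self \<open>c \<ge> 0\<close>, of "\<beta> n"]
        by (intro mult_right_mono) auto
      also have "\<dots> \<le> c * B"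
        using mult_left_mono[OF B(2)[OF n(2)] \<open>c \<ge> 0\<close>] by (simp add: mult.assoc)
      finally show "(\<bar>m n\<bar> * real n ^ k)\<^sup>2 \<le> c * B" .
    qed
    then have "bdd_above ((\<lambda>n. \<bar>m n\<bar> * real n ^ k) ` {max N 1..})"
      by (intro bdd_aboveI2) auto
    \<comment> \<open>The hypothesis says nothing about indices below \<open>N\<close>, but these
      are finitely many. Including index \<open>0\<close> is harmless for the same reason.\<close>
    moreover have "bdd_above ((\<lambda>n. \<bar>m n\<bar> * real n ^ k) ` {..max N 1})"
      by (intro bdd_above_finite finite_imageI) auto
    ultimately have "bdd_above ((\<lambda>n. \<bar>m n\<bar> * real n ^ k) ` ({max N 1..} \<union> {..max N 1}))"
      by (simp add: image_Un)
    then show ?thesis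
      by (rule bdd_above_mono) auto
  qed
  then show ?thesis
    using m by (simp add: rapidly_decreasing_def)
qed

lemma rapidly_decreasing_eventually_le:
  assumes "\<beta> \<in> rapidly_decreasing" "\<epsilon> > 0"
  obtains N where "\<And>n. n \<ge> N \<Longrightarrow> n \<ge> 1 \<Longrightarrow> \<beta> n \<le> \<epsilon>"
proof -
  obtain B where B: "B \<ge> 0" "\<And>n. n \<ge> 1 \<Longrightarrow> \<bar>\<beta> n\<bar> * real n ^ 1 \<le> B"
    using rapidly_decreasingE[OF assms(1)] by metis
  obtain N where N: "real N > B / \<epsilon>"
    using reals_Archimedean2 by blast
  have "\<beta> n \<le> \<epsilon>" if n: "n \<ge> N" "n \<ge> 1" for n
  proof -
    have "\<bar>\<beta> n\<bar> * real n \<le> B" using B(2)[OF n(2)] by simp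
    also have "\<dots> \<le> \<epsilon> * real N" using N \<open>\<epsilon> > 0\<close> by (simp add: field_simps)
    also have "\<dots> \<le> \<epsilon> * real n" using n \<open>\<epsilon> > 0\<close> by simp
    finally show ?thesis using n(2) by simp
  qed
  then show thesis by (rule that)
qed

text \<open>Comparison with t = 0 leaves a term b m^2 on the right. For b \<le> \<alpha> / 4 it is
  absorbed by half of \<alpha> / 2 * m^2, and \<alpha> / 4 * m^2 \<le> 2 b remains.\<close>

lemma minimiser_square_le:
  fixes f :: "real \<Rightarrow> real"
  assumes "\<alpha> > 0" "\<alpha> \<le> a" "b \<le> \<alpha> / 4"
    and f: "\<And>t. \<bar>f t\<bar> \<le> b * (1 + t\<^sup>2)"
    and m: "\<And>t. a / 2 * m\<^sup>2 + f m \<le> a / 2 * t\<^sup>2 + f t"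
  shows "m\<^sup>2 \<le> 8 / \<alpha> * b"
proof -
  have "\<alpha> / 2 * m\<^sup>2 \<le> a / 2 * m\<^sup>2"
    using assms(2) by (intro mult_right_mono) auto
  also have "\<dots> \<le> f 0 - f m"
    using m[of 0] by simp
  also have "\<dots> \<le> 2 * b + b * m\<^sup>2"
    using f[of 0] f[of m] by (simp add: algebra_simps)
  also have "\<dots> \<le> 2 * b + \<alpha> / 4 * m\<^sup>2"
    using assms(3) by (intro add_left_mono mult_right_mono) auto
  finally show ?thesis
    using \<open>\<alpha> > 0\<close> by (simp add: field_simps)
qed

text \<open>Merging the two series, with the factor 1 / 2 moved inside, allows functional values to
  be compared coordinate by coordinate.\<close>

lemma Fs_functional_eq_suminf:
  assumes "summable (\<lambda>n. a (Suc n) * (x (Suc n))\<^sup>2)" "summable (\<lambda>n. f (Suc n) (x (Suc n)))"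
  shows "summable (\<lambda>n. a (Suc n) / 2 * (x (Suc n))\<^sup>2 + f (Suc n) (x (Suc n)))"
    and "Fs_functional a f x = (\<Sum>n. a (Suc n) / 2 * (x (Suc n))\<^sup>2 + f (Suc n) (x (Suc n)))"
proof -
  have "(\<lambda>n. 1 / 2 * (a (Suc n) * (x (Suc n))\<^sup>2) + f (Suc n) (x (Suc n))) sums Fs_functional a f x"
    unfolding Fs_functional_def
    by (intro sums_add sums_mult summable_sums assms)
  then have "(\<lambda>n. a (Suc n) / 2 * (x (Suc n))\<^sup>2 + f (Suc n) (x (Suc n))) sums Fs_functional a f x"
    by simp
  then show "summable (\<lambda>n. a (Suc n) / 2 * (x (Suc n))\<^sup>2 + f (Suc n) (x (Suc n)))"
    and "Fs_functional a f x = (\<Sum>n. a (Suc n) / 2 * (x (Suc n))\<^sup>2 + f (Suc n) (x (Suc n)))"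
    by (auto simp: sums_iff)
qed

text \<open>The differences v n - u n are nonnegative and sum to 0, so each of them vanishes. This
  turns equality of functional values into equality in every coordinate.\<close>

lemma suminf_le_imp_eq:
  fixes u v :: "nat \<Rightarrow> real"
  assumes "summable u" "summable v" "\<And>n. u n \<le> v n" "suminf v \<le> suminf u"
  shows "v n = u n"
proof -
  have "suminf (\<lambda>n. v n - u n) = 0"
    using assms(4) suminf_le[OF assms(3,1,2)] suminf_diff[OF assms(2,1)] by simp
  then show ?thesis
    using suminf_eq_zero_iff[OF summable_diff[OF assms(2,1)]] assms(3) by simp
qed

theorem corollary3p7:
  fixes a :: "nat \<Rightarrow> real" and f :: "nat \<Rightarrow> real \<Rightarrow> real"
  assumes "(a, f) \<in> class_Fs"
  shows "\<exists>!x0. x0 \<in> rapidly_decreasing \<and>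
           (\<forall>x\<in>rapidly_decreasing. Fs_functional a f x0 \<le> Fs_functional a f x)"
proof -
  have f: "\<And>n. n \<ge> 1 \<Longrightarrow> f n C1_differentiable_on UNIV"
      "\<And>n. n \<ge> 1 \<Longrightarrow> convex_on UNIV (f n)"
    and ex_a: "\<exists>\<alpha> M. \<alpha> > 0 \<and> M > 0 \<and> (\<forall>n\<ge>1. \<alpha> \<le> a n \<and> a n \<le> M)"
    and ex_\<beta>: "\<exists>\<beta>\<in>rapidly_decreasing. \<forall>n\<ge>1. \<beta> n \<ge> 0 \<and> (\<forall>t. \<bar>f n t\<bar> \<le> \<beta> n * (1 + t\<^sup>2))"
    and ex_\<gamma>: "\<exists>\<gamma>. \<forall>n\<ge>1. \<forall>t. f n t \<ge> - \<gamma> n"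
    using assms unfolding class_Fs_def by auto
  from ex_a obtain \<alpha> M where \<alpha>: "\<alpha> > 0"
    and a: "\<And>n. n \<ge> 1 \<Longrightarrow> \<alpha> \<le> a n" "\<And>n. n \<ge> 1 \<Longrightarrow> a n \<le> M"
    by metis
  from ex_\<beta> obtain \<beta> where \<beta>: "\<beta> \<in> rapidly_decreasing"
      "\<And>n t. n \<ge> 1 \<Longrightarrow> \<bar>f n t\<bar> \<le> \<beta> n * (1 + t\<^sup>2)"
    by metis
  from ex_\<gamma> obtain \<gamma> where \<gamma>: "\<And>n t. n \<ge> 1 \<Longrightarrow> f n t \<ge> - \<gamma> n"
    by metis
  have a_pos: "a n > 0" if "n \<ge> 1" for n
    using a(1)[OF that] \<alpha> by simp
  define g where "g n t = a n / 2 * t\<^sup>2 + f n t" for n t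
  have "\<exists>m. \<forall>t. g n m \<le> g n t" if n: "n \<ge> 1" for n
    unfolding g_def
    by (meson ex_minimiser_quadratic_plus[of "a n" "f n" "\<gamma> n"] a_pos[OF n] \<gamma>[OF n]
        C1_differentiable_imp_continuous_on[OF f(1)[OF n]])
  then obtain m' where m': "\<And>n t. n \<ge> 1 \<Longrightarrow> g n (m' n) \<le> g n t"
    by metis
  \<comment> \<open>The choice \<open>m'\<close> is arbitrary at \<open>0\<close>; restricting it
    puts \<open>m\<close> into the extensional product over \<open>{1..}\<close>.\<close>
  define m where "m = restrict m' {1..}"
  have m: "g n (m n) \<le> g n t" if "n \<ge> 1" for n t
    using m'[OF that] that by (simp add: m_def)
  \<comment> \<open>From \<open>N\<close> on, \<beta> is small enough for the absorption in
    \<open>minimiser_square_le\<close>.\<close>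
  obtain N where N: "\<And>n. n \<ge> N \<Longrightarrow> n \<ge> 1 \<Longrightarrow> \<beta> n \<le> \<alpha> / 4"
    using rapidly_decreasing_eventually_le[OF \<beta>(1), of "\<alpha> / 4"] \<alpha> by auto
  have m_rd: "m \<in> rapidly_decreasing"
  proof (rule rapidly_decreasing_of_square_le[OF \<beta>(1)])
    show "(m n)\<^sup>2 \<le> 8 / \<alpha> * \<beta> n" if n: "n \<ge> N" "n \<ge> 1" for n
      using minimiser_square_le[OF \<alpha> a(1)[OF n(2)] N[OF n] \<beta>(2)[OF n(2)]] m[OF n(2)]
      unfolding g_def by blast
  qed (use \<alpha> in \<open>auto simp: m_def\<close>)
  have a_abs: "\<bar>a n\<bar> \<le> M" if "n \<ge> 1" for n
    using a_pos[OF that] a(2)[OF that] by simp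
  have F: "summable (\<lambda>n. g (Suc n) (x (Suc n)))"
      "Fs_functional a f x = (\<Sum>n. g (Suc n) (x (Suc n)))" if x: "x \<in> rapidly_decreasing" for x
  proof -
    have "summable (\<lambda>n. a (Suc n) * (x (Suc n))\<^sup>2)"
      using a_abs x by (rule summable_mult_power2_rapidly_decreasing)
    moreover have "summable (\<lambda>n. f (Suc n) (x (Suc n)))"
      using \<beta> x by (rule summable_comp_rapidly_decreasing)
    ultimately show "summable (\<lambda>n. g (Suc n) (x (Suc n)))"
        "Fs_functional a f x = (\<Sum>n. g (Suc n) (x (Suc n)))"
      unfolding g_def by (rule Fs_functional_eq_suminf)+
  qed
  show ?thesis
  proof (intro ex1I conjI ballI)
    show "m \<in> rapidly_decreasing" by (rule m_rd)
  next
    fix x assume x: "x \<in> rapidly_decreasing"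
    show "Fs_functional a f m \<le> Fs_functional a f x"
      unfolding F(2)[OF x] F(2)[OF m_rd] by (intro suminf_le m F(1) x m_rd) simp
  next
    fix y assume "y \<in> rapidly_decreasing \<and>
      (\<forall>x\<in>rapidly_decreasing. Fs_functional a f y \<le> Fs_functional a f x)"
    then have y: "y \<in> rapidly_decreasing" and "Fs_functional a f y \<le> Fs_functional a f m"
      using m_rd by auto
    then have le: "(\<Sum>n. g (Suc n) (y (Suc n))) \<le> (\<Sum>n. g (Suc n) (m (Suc n)))"
      using F(2) m_rd by simp
    show "y = m"
    proof (rule rapidly_decreasing_eqI[OF y m_rd])
      fix n
      \<comment> \<open>Each term at \<open>y\<close> is at least the one at \<open>m\<close>, while
        the sum is no larger, so the terms agree and \<open>y (Suc n)\<close> also minimises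
        \<open>g (Suc n)\<close>.\<close>
      have "g (Suc n) (y (Suc n)) = g (Suc n) (m (Suc n))"
        using suminf_le_imp_eq[OF F(1)[OF m_rd] F(1)[OF y] m le] by simp
      then show "y (Suc n) = m (Suc n)"
        unfolding g_def
        by (rule unique_minimiser_quadratic_plus_convex[rotated 3])
          (use a_pos f(2) m[unfolded g_def] in simp_all)
    qed
  qed
qed

end
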